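(* Let $n \geq 1$ be a positive integer. There exists a $\chi_g$-upper-game-vertex-critical graph $G$ such that $$\left\{\chi_g(G)-\chi_g(G-x) \, | \, x \in V(G)\right\}=\{-1,-n\}.$$
   Context: All graphs are simple, undirected and finite. The coloring game on a graph $G$ with color set $\{1,\ldots,k\}$ is played by Alice and Bob. Alice moves first and the players alternate turns; in each turn the player colors a previously uncolored vertex with a color from $\{1,\ldots,k\}$ different from the colors already given to its neighbors. If at some point there is an uncolored vertex having all colors $1,\ldots,k$ in its neighborhood, Bob wins; otherwise, if all vertices get colored, Alice wins. The game chromatic number $\chi_g(G)$ is the minimum $k$ for which Alice has a winning strategy on $G$. For $x\in V(G)$, $G-x$ is the graph obtained from $G$ by deleting $x$ and all edges incident with $x$. A graph $G$ is $\chi_g$-upper-game-vertex-critical if $\chi_g(G-x)>\chi_g(G)$ for every $x\in V(G)$. *)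

theory Defs
  imports "Graph_Theory.Digraph"
begin

text \<open>
  Finite simple undirected graphs are those satisfying the locale predicate \<^const>\<open>graph\<close>:
  finite symmetric digraphs without loops and parallel arcs.

  A position of the coloring game is a partial coloring \<open>c :: 'a \<rightharpoonup> nat\<close>; the colors are
  \<open>{1..k}\<close>.
\<close>

definition legal_move ::
    "('a, 'b) pre_digraph \<Rightarrow> nat \<Rightarrow> ('a \<rightharpoonup> nat) \<Rightarrow> 'a \<times> nat \<Rightarrow> bool" where
  "legal_move G k c m \<longleftrightarrow>
     (case m of (v, i) \<Rightarrow>
        v \<in> verts G \<and> c v = None \<and> i \<in> {1..k} \<and> (\<forall>u. u \<rightarrow>\<^bsub>G\<^esub> v \<longrightarrow> c u \<noteq> Some i))"

definition blocked_vertex_exists ::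
    "('a, 'b) pre_digraph \<Rightarrow> nat \<Rightarrow> ('a \<rightharpoonup> nat) \<Rightarrow> bool" where
  "blocked_vertex_exists G k c \<longleftrightarrow>
     (\<exists>v\<in>verts G. c v = None \<and> (\<forall>i\<in>{1..k}. \<exists>u. u \<rightarrow>\<^bsub>G\<^esub> v \<and> c u = Some i))"

text \<open>
  A history is the list of moves made so far, latest move first, so \<^term>\<open>map_of h\<close> is the
  position reached and Alice is to move iff the length of \<open>h\<close> is even.  A strategy for Alice
  maps histories to moves.  If it proposes an illegal move, the play cannot be continued there.
\<close>

inductive consistent_play ::
    "('a, 'b) pre_digraph \<Rightarrow> nat \<Rightarrow> (('a \<times> nat) list \<Rightarrow> 'a \<times> nat) \<Rightarrow> ('a \<times> nat) list \<Rightarrow> bool"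
  for G k \<sigma> where
  start: "consistent_play G k \<sigma> []"
| alice: "\<lbrakk>consistent_play G k \<sigma> h; even (length h); legal_move G k (map_of h) (\<sigma> h)\<rbrakk>
          \<Longrightarrow> consistent_play G k \<sigma> (\<sigma> h # h)"
| bob: "\<lbrakk>consistent_play G k \<sigma> h; odd (length h); legal_move G k (map_of h) m\<rbrakk>
        \<Longrightarrow> consistent_play G k \<sigma> (m # h)"

text \<open>
  The second conjunct below says that a play which cannot be continued has colored every vertex;
  on finite graphs every play reaches such an end.
\<close>

definition winning_strategy ::
    "('a, 'b) pre_digraph \<Rightarrow> nat \<Rightarrow> (('a \<times> nat) list \<Rightarrow> 'a \<times> nat) \<Rightarrow> bool" where
  "winning_strategy G k \<sigma> \<longleftrightarrow>
     (\<forall>h. consistent_play G k \<sigma> h \<longrightarrow>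
        \<not> blocked_vertex_exists G k (map_of h) \<and>
        ((\<nexists>m. consistent_play G k \<sigma> (m # h)) \<longrightarrow> verts G \<subseteq> dom (map_of h)))"

text \<open>
  On a finite graph the minimum exists: Alice wins as soon as there are as many colors as vertices.
\<close>

definition game_chromatic_number :: "('a, 'b) pre_digraph \<Rightarrow> nat" where
  "game_chromatic_number G = (LEAST k. \<exists>\<sigma>. winning_strategy G k \<sigma>)"

definition upper_game_vertex_critical :: "('a, 'b) pre_digraph \<Rightarrow> bool" where
  "upper_game_vertex_critical G \<longleftrightarrow>
     (\<forall>x\<in>verts G. game_chromatic_number (pre_digraph.del_vert G x) > game_chromatic_number G)"

end

theory Submission
  imports Defs
begin

text \<open>
  Let \<open>G\<close> be the disjoint union of an isolated vertex \<open>w\<close> and the crown graph \<open>K\<^sub>m\<^sub>,\<^sub>m\<close> minus a perfect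
  matching, with \<open>m = n + 2\<close>. On \<open>G\<close> two colors suffice: Alice plays \<open>w\<close> and answers Bob's first
  move on the matched vertex with the other color, which forces all the rest. On \<open>G - w\<close> she has
  lost this tempo: Bob copies each of her colors to the matched vertex, and \<open>m\<close> colors are needed.
  If a vertex \<open>x\<close> of the crown is deleted, Bob refutes two colors in at most two moves, while
  three colors suffice for Alice, who starts on the vertex that was matched with \<open>x\<close>.
\<close>

section \<open>Winning criteria for the coloring game\<close>

text \<open>A blocked vertex admits no legal color, so the move is made elsewhere and the block
  remains. Hence freedom from blocks need only be checked after Alice's moves.\<close>

lemma blocked_vertex_exists_mono:
  assumes "blocked_vertex_exists G k c" "legal_move G k c m"
  shows "blocked_vertex_exists G k (c(fst m \<mapsto> snd m))"
proof -
  obtain v where v: "v \<in> verts G" "c v = None" "\<forall>i\<in>{1..k}. \<exists>u. u \<rightarrow>\<^bsub>G\<^esub> v \<and> c u = Some i"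
    using assms(1) by (auto simp: blocked_vertex_exists_def)
  have m: "c (fst m) = None" "snd m \<in> {1..k}" "\<forall>u. u \<rightarrow>\<^bsub>G\<^esub> fst m \<longrightarrow> c u \<noteq> Some (snd m)"
    using assms(2) by (auto simp: legal_move_def split: prod.splits)
  have "fst m \<noteq> v" using v m by metis
  then show ?thesis
    unfolding blocked_vertex_exists_def using v m(1)
    by (metis fun_upd_apply option.distinct(1))
qed

lemma legal_move_exists:
  assumes "\<not> blocked_vertex_exists G k c" "\<not> verts G \<subseteq> dom c"
  shows "\<exists>v i. legal_move G k c (v, i)"
proof -
  obtain v where "v \<in> verts G" "c v = None" using assms(2) by auto
  then show ?thesis
    using assms(1) unfolding blocked_vertex_exists_def legal_move_def by fastforce
qed

text \<open>\<open>Q\<close> describes the positions that Alice leaves to Bob.\<close>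

lemma winning_strategyI:
  assumes first: "\<exists>v i. legal_move G k Map.empty (v, i) \<and> Q [v \<mapsto> i]"
    and unblocked: "\<And>c. Q c \<Longrightarrow> \<not> blocked_vertex_exists G k c"
    and reply: "\<And>c v i. \<lbrakk>Q c; legal_move G k c (v, i)\<rbrakk> \<Longrightarrow> verts G \<subseteq> dom (c(v \<mapsto> i)) \<or>
      (\<exists>v' i'. legal_move G k (c(v \<mapsto> i)) (v', i') \<and> Q (c(v \<mapsto> i, v' \<mapsto> i')))"
  shows "\<exists>\<sigma>. winning_strategy G k \<sigma>"
proof -
  define ok where "ok = (\<lambda>c m. legal_move G k c m \<and> Q (c(fst m \<mapsto> snd m)))"
  define \<sigma> where "\<sigma> = (\<lambda>h. SOME m. ok (map_of h) m)"
  \<comment> \<open>The invariant at Alice's turns, the counterpart of \<open>Q\<close> at Bob's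
    turns.\<close>
  define safe where "safe = (\<lambda>c. verts G \<subseteq> dom c \<or> (\<exists>m. ok c m))"
  have \<sigma>: "ok (map_of h) (\<sigma> h)" if "\<exists>m. ok (map_of h) m" for h
    using someI_ex[OF that] by (simp add: \<sigma>_def)
  have inv: "if even (length h) then safe (map_of h) else Q (map_of h)"
    if "consistent_play G k \<sigma> h" for h
    using that
  proof induction
    case start
    then show ?case using first by (auto simp: safe_def ok_def)
  next
    case (alice h)
    then have "\<not> verts G \<subseteq> dom (map_of h)" by (auto simp: legal_move_def split: prod.splits)
    then have "ok (map_of h) (\<sigma> h)" using alice \<sigma> by (auto simp: safe_def)
    then show ?case using alice by (simp add: ok_def)
  next
    case (bob h m)
    obtain v i where m: "m = (v, i)" by force
    from bob have "Q (map_of h)" by simp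
    from reply[OF this, of v i] bob m show ?case
      by (auto simp: safe_def ok_def)
  qed
  have "\<not> blocked_vertex_exists G k (map_of h) \<and>
        ((\<nexists>m. consistent_play G k \<sigma> (m # h)) \<longrightarrow> verts G \<subseteq> dom (map_of h))"
    if h: "consistent_play G k \<sigma> h" for h
  proof (cases "even (length h)")
    case True
    then have "safe (map_of h)" using inv[OF h] by simp
    moreover have "\<not> blocked_vertex_exists G k (map_of h)" if "verts G \<subseteq> dom (map_of h)"
      using that by (auto simp: blocked_vertex_exists_def)
    moreover have "\<not> blocked_vertex_exists G k (map_of h) \<and> (\<exists>m. consistent_play G k \<sigma> (m # h))"
      if "\<exists>m. ok (map_of h) m"
    proof -
      have *: "legal_move G k (map_of h) (\<sigma> h)"
        "Q ((map_of h)(fst (\<sigma> h) \<mapsto> snd (\<sigma> h)))" using \<sigma>[OF that] by (auto simp: ok_def)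
      then show ?thesis
        using blocked_vertex_exists_mono unblocked h True consistent_play.alice by metis
    qed
    ultimately show ?thesis unfolding safe_def by blast
  next
    case False
    then have "\<not> blocked_vertex_exists G k (map_of h)" using inv[OF h] unblocked by simp
    then show ?thesis
      using legal_move_exists[of G k "map_of h"] consistent_play.bob[OF h False] by blast
  qed
  then show ?thesis unfolding winning_strategy_def by blast
qed

section \<open>Dead positions and wins for Bob\<close>

definition proper_coloring :: "('a, 'b) pre_digraph \<Rightarrow> nat \<Rightarrow> ('a \<rightharpoonup> nat) \<Rightarrow> bool" where
  "proper_coloring G k c \<longleftrightarrow>
     (\<forall>v i. c v = Some i \<longrightarrow> i \<in> {1..k}) \<and> (\<forall>u v i. u \<rightarrow>\<^bsub>G\<^esub> v \<longrightarrow> c u = Some i \<longrightarrow> c v \<noteq> Some i)"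

text \<open>Bob's analysis can stop at such a position, possibly long before a vertex is actually
  blocked.\<close>

definition dead_position :: "('a, 'b) pre_digraph \<Rightarrow> nat \<Rightarrow> ('a \<rightharpoonup> nat) \<Rightarrow> bool" where
  "dead_position G k c \<longleftrightarrow> (\<nexists>d. c \<subseteq>\<^sub>m d \<and> verts G \<subseteq> dom d \<and> proper_coloring G k d)"

text \<open>Legality looks only at arcs into the new vertex; symmetry covers the arcs out of it, and
  the absence of loops covers the vertex itself.\<close>

lemma consistent_play_proper:
  assumes "symmetric G" "loopfree_digraph G" "consistent_play G k \<sigma> h"
  shows "proper_coloring G k (map_of h)"
proof -
  have sym: "v \<rightarrow>\<^bsub>G\<^esub> u" if "u \<rightarrow>\<^bsub>G\<^esub> v" for u v
    using assms(1) that by (auto simp: symmetric_def sym_def)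
  have irr: "\<not> v \<rightarrow>\<^bsub>G\<^esub> v" for v
    using assms(2) loopfree_digraph.no_loops by (fastforce simp: arcs_ends_def arc_to_ends_def)
  have step: "proper_coloring G k (c(fst m \<mapsto> snd m))"
    if "proper_coloring G k c" "legal_move G k c m" for c m
  proof -
    have c: "\<And>v i. c v = Some i \<Longrightarrow> i \<in> {1..k}" "\<And>u v i. u \<rightarrow>\<^bsub>G\<^esub> v \<Longrightarrow> c u = Some i \<Longrightarrow> c v \<noteq> Some i"
      using that(1) unfolding proper_coloring_def by blast+
    have m: "snd m \<in> {1..k}" "\<And>u. u \<rightarrow>\<^bsub>G\<^esub> fst m \<Longrightarrow> c u \<noteq> Some (snd m)"
      using that(2) by (auto simp: legal_move_def split: prod.splits)
    show ?thesis
      unfolding proper_coloring_def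
    proof (intro conjI allI impI)
      fix u v i
      show "(c(fst m \<mapsto> snd m)) v = Some i \<Longrightarrow> i \<in> {1..k}"
        using c(1)[of v i] m(1) by (auto split: if_splits)
      assume "u \<rightarrow>\<^bsub>G\<^esub> v" "(c(fst m \<mapsto> snd m)) u = Some i"
      then show "(c(fst m \<mapsto> snd m)) v \<noteq> Some i"
        using c(2)[of u v i] m(2)[of u] m(2)[of v] sym[of u v] irr[of v] by (auto split: if_splits)
    qed
  qed
  show ?thesis
    using assms(3)
  proof induction
    case start
    then show ?case by (simp add: proper_coloring_def)
  next
    case (alice h)
    then show ?case using step[of "map_of h" "\<sigma> h"] by (cases "\<sigma> h") (simp add: fun_upd_def)
  next
    case (bob h m)
    then show ?case using step[of "map_of h" m] by (cases m) (simp add: fun_upd_def)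
  qed
qed

text \<open>A winning strategy lets the play continue until all vertices are colored, and the final
  proper coloring extends the current position.\<close>

lemma winning_strategy_not_dead:
  assumes "graph G" "winning_strategy G k \<sigma>" "consistent_play G k \<sigma> h"
  shows "\<not> dead_position G k (map_of h)"
  using assms(3)
proof (induction "card (verts G - dom (map_of h))" arbitrary: h rule: less_induct)
  case less
  interpret graph G by fact
  show ?case
  proof (cases "verts G \<subseteq> dom (map_of h)")
    case True
    then show ?thesis
      using consistent_play_proper[OF sym_arcs loopfree_digraph_axioms less.prems]
      unfolding dead_position_def by (meson map_le_refl)
  next
    case False
    then obtain m where m: "consistent_play G k \<sigma> (m # h)"
      using assms(2) less.prems unfolding winning_strategy_def by blast
    then have "legal_move G k (map_of h) m" by cases auto
    then have new: "fst m \<in> verts G" "map_of h (fst m) = None"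
      by (auto simp: legal_move_def split: prod.splits)
    have "card (verts G - dom (map_of (m # h))) < card (verts G - dom (map_of h))"
      by (rule psubset_card_mono) (use new in auto)
    from less.hyps[OF this m] obtain d where
      d: "map_of (m # h) \<subseteq>\<^sub>m d" "verts G \<subseteq> dom d" "proper_coloring G k d"
      by (auto simp: dead_position_def)
    have "map_of h \<subseteq>\<^sub>m map_of (m # h)" using new by (auto simp: map_le_def)
    then show ?thesis using d map_le_trans unfolding dead_position_def by blast
  qed
qed

text \<open>The Boolean argument says whether Alice is to move.\<close>

inductive bob_wins :: "('a, 'b) pre_digraph \<Rightarrow> nat \<Rightarrow> bool \<Rightarrow> ('a \<rightharpoonup> nat) \<Rightarrow> bool"
  for G k where
  dead: "dead_position G k c \<Longrightarrow> bob_wins G k a c"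
| alice: "\<lbrakk>\<not> verts G \<subseteq> dom c; \<And>v i. legal_move G k c (v, i) \<Longrightarrow> bob_wins G k False (c(v \<mapsto> i))\<rbrakk>
          \<Longrightarrow> bob_wins G k True c"
| bob: "\<lbrakk>legal_move G k c (v, i); bob_wins G k True (c(v \<mapsto> i))\<rbrakk> \<Longrightarrow> bob_wins G k False c"

text \<open>Playing \<open>\<sigma>\<close> against the derivation of \<open>bob_wins\<close> leads
  to a dead position, or to a position where Alice must move but cannot.\<close>

lemma bob_wins_no_winning_strategy:
  assumes "graph G" "bob_wins G k True Map.empty"
  shows "\<not> winning_strategy G k \<sigma>"
proof
  assume win: "winning_strategy G k \<sigma>"
  have False if "bob_wins G k a c" "consistent_play G k \<sigma> h" "map_of h = c" "even (length h) = a"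
    for a c h
    using that
  proof (induction arbitrary: h)
    case (dead c a)
    then show ?case using winning_strategy_not_dead[OF assms(1) win] by blast
  next
    case (alice c)
    then obtain m where m: "consistent_play G k \<sigma> (m # h)"
      using win unfolding winning_strategy_def by blast
    then have "legal_move G k c (fst m, snd m)" using alice.prems by cases auto
    from alice.IH[OF this m] alice.prems show ?case by auto
  next
    case (bob c v i)
    have "consistent_play G k \<sigma> ((v, i) # h)"
      using bob consistent_play.bob by metis
    from bob.IH[OF this] bob.prems show ?case by auto
  qed
  from this[OF assms(2) consistent_play.start] show False by simp
qed

text \<open>Bob has to win for every smaller number of colors, since no monotonicity in the number
  of colors is assumed.\<close>

lemma game_chromatic_number_eqI:
  assumes "graph G" "\<exists>\<sigma>. winning_strategy G k \<sigma>"
    "\<And>j. j < k \<Longrightarrow> bob_wins G j True Map.empty"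
  shows "game_chromatic_number G = k"
  unfolding game_chromatic_number_def
  using assms bob_wins_no_winning_strategy by (intro Least_equality) (auto simp: not_less[symmetric])

text \<open>Replaces extensions of a partial map by total functions \<open>e\<close>, so that
  refutations compare plain color values.\<close>

lemma dead_positionI:
  assumes "\<And>e. \<lbrakk>\<And>v. v \<in> verts G \<Longrightarrow> e v \<in> {1..k};
      \<And>u v. \<lbrakk>u \<in> verts G; v \<in> verts G; u \<rightarrow>\<^bsub>G\<^esub> v\<rbrakk> \<Longrightarrow> e u \<noteq> e v;
      \<And>v i. c v = Some i \<Longrightarrow> e v = i\<rbrakk> \<Longrightarrow> False"
  shows "dead_position G k c"
  unfolding dead_position_def
proof safe
  fix d assume d: "c \<subseteq>\<^sub>m d" "verts G \<subseteq> dom d" "proper_coloring G k d"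
  have e: "d v = Some (the (d v))" if "v \<in> verts G" for v using d(2) that by force
  show False
  proof (rule assms)
    show "the (d v) \<in> {1..k}" if "v \<in> verts G" for v
      using e[OF that] d(3) unfolding proper_coloring_def by blast
    show "the (d u) \<noteq> the (d v)" if "u \<in> verts G" "v \<in> verts G" "u \<rightarrow>\<^bsub>G\<^esub> v" for u v
      using e that d(3) unfolding proper_coloring_def by metis
    show "the (d v) = i" if "c v = Some i" for v i
      using d(1) that unfolding map_le_def by (metis domI option.sel)
  qed
qed

lemma bob_wins_edge:
  assumes "x \<rightarrow>\<^bsub>G\<^esub> y" "x \<in> verts G" "y \<in> verts G" "k < 2"
  shows "bob_wins G k True Map.empty"
proof (rule bob_wins.dead, rule dead_positionI)
  fix e assume "\<And>v. v \<in> verts G \<Longrightarrow> e v \<in> {1..k}"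
    "\<And>u v. \<lbrakk>u \<in> verts G; v \<in> verts G; u \<rightarrow>\<^bsub>G\<^esub> v\<rbrakk> \<Longrightarrow> e u \<noteq> e v"
  then have "e x \<in> {1..k}" "e y \<in> {1..k}" "e x \<noteq> e y" using assms by auto
  then show False using assms(4) by auto
qed

section \<open>Sufficient conditions for Alice to win\<close>

text \<open>Fewer than \<open>k\<close> neighbors cannot show all \<open>k\<close> colors, so
  arbitrary legal play wins and the invariant is trivial. Nonemptiness provides the first
  move.\<close>

lemma winning_strategy_small_degree:
  assumes "verts G \<noteq> {}" "\<And>v. v \<in> verts G \<Longrightarrow> finite {u. u \<rightarrow>\<^bsub>G\<^esub> v} \<and> card {u. u \<rightarrow>\<^bsub>G\<^esub> v} < k"
  shows "\<exists>\<sigma>. winning_strategy G k \<sigma>"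
proof (rule winning_strategyI[where Q = "\<lambda>_. True"])
  show unblocked: "\<not> blocked_vertex_exists G k c" for c
  proof
    assume "blocked_vertex_exists G k c"
    then obtain v where v: "v \<in> verts G" "\<And>i. i \<in> {1..k} \<Longrightarrow> \<exists>u. u \<rightarrow>\<^bsub>G\<^esub> v \<and> c u = Some i"
      unfolding blocked_vertex_exists_def by blast
    have "{1..k} \<subseteq> (\<lambda>u. the (c u)) ` {u. u \<rightarrow>\<^bsub>G\<^esub> v}" using v(2) by force
    then have "card {1..k} \<le> card {u. u \<rightarrow>\<^bsub>G\<^esub> v}" using assms(2)[OF v(1)] surj_card_le by blast
    then show False using assms(2)[OF v(1)] by simp
  qed
  show "\<exists>v i. legal_move G k Map.empty (v, i) \<and> True"
    using legal_move_exists[OF unblocked, of Map.empty] assms(1) by auto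
  show "verts G \<subseteq> dom (c(v \<mapsto> i)) \<or>
      (\<exists>v' i'. legal_move G k (c(v \<mapsto> i)) (v', i') \<and> True)" for c v i
    using legal_move_exists[OF unblocked] by blast
qed

text \<open>Every vertex \<open>y\<close> has a reserved color \<open>f y\<close> that no neighbor of \<open>y\<close> has or can ever get.\<close>

definition reserved :: "('a, 'b) pre_digraph \<Rightarrow> nat \<Rightarrow> ('a \<rightharpoonup> nat) \<Rightarrow> bool" where
  "reserved G k c \<longleftrightarrow> (\<exists>f. \<forall>y\<in>verts G. f y \<in> {1..k} \<and>
     (\<forall>z. z \<rightarrow>\<^bsub>G\<^esub> y \<longrightarrow> c z \<noteq> Some (f y) \<and> (c z = None \<longrightarrow> (\<exists>t. t \<rightarrow>\<^bsub>G\<^esub> z \<and> c t = Some (f y)))))"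

lemma reserved_unblocked: "reserved G k c \<Longrightarrow> \<not> blocked_vertex_exists G k c"
  unfolding reserved_def blocked_vertex_exists_def by blast

text \<open>If the move colors a neighbor \<open>z\<close> of \<open>y\<close>, then
  \<open>z\<close> already saw \<open>f y\<close> and so receives another color. From a reserved
  position Alice may therefore play arbitrarily.\<close>

lemma reserved_legal_move:
  assumes "reserved G k c" "legal_move G k c (v, i)"
  shows "reserved G k (c(v \<mapsto> i))"
proof -
  obtain f where f: "\<And>y. y \<in> verts G \<Longrightarrow> f y \<in> {1..k}"
    "\<And>y z. \<lbrakk>y \<in> verts G; z \<rightarrow>\<^bsub>G\<^esub> y\<rbrakk> \<Longrightarrow> c z \<noteq> Some (f y)"
    "\<And>y z. \<lbrakk>y \<in> verts G; z \<rightarrow>\<^bsub>G\<^esub> y; c z = None\<rbrakk> \<Longrightarrow> \<exists>t. t \<rightarrow>\<^bsub>G\<^esub> z \<and> c t = Some (f y)"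
    using assms(1) unfolding reserved_def by metis
  have v: "c v = None" "\<And>u. u \<rightarrow>\<^bsub>G\<^esub> v \<Longrightarrow> c u \<noteq> Some i"
    using assms(2) by (auto simp: legal_move_def)
  have "(c(v \<mapsto> i)) z \<noteq> Some (f y) \<and>
      ((c(v \<mapsto> i)) z = None \<longrightarrow> (\<exists>t. t \<rightarrow>\<^bsub>G\<^esub> z \<and> (c(v \<mapsto> i)) t = Some (f y)))"
    if y: "y \<in> verts G" "z \<rightarrow>\<^bsub>G\<^esub> y" for y z
  proof (cases "z = v")
    case True
    then show ?thesis using f(3)[OF y] v by auto
  next
    case False
    then show ?thesis using f(2,3)[OF y] v(1) by (metis fun_upd_apply option.distinct(1))
  qed
  then show ?thesis unfolding reserved_def using f(1) by (intro exI[of _ f]) simp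
qed

lemma reserved_reply:
  assumes "reserved G k c"
  shows "verts G \<subseteq> dom c \<or> (\<exists>v i. legal_move G k c (v, i) \<and> reserved G k (c(v \<mapsto> i)))"
  using legal_move_exists[OF reserved_unblocked[OF assms]] reserved_legal_move[OF assms] by blast

section \<open>Crown graphs\<close>

text \<open>The vertices below \<open>2 * m\<close> carry a crown graph whose sides are the even and the odd numbers;
  all other vertices are isolated.\<close>

definition mate :: "nat \<Rightarrow> nat" where
  "mate x = (if even x then x + 1 else x - 1)"

lemma mate_mate [simp]: "mate (mate x) = x"
  by (auto simp: mate_def)

lemma even_mate [simp]: "even (mate x) \<longleftrightarrow> odd x"
  by (auto simp: mate_def)

lemma mate_eq_iff: "mate x = y \<longleftrightarrow> x = mate y"
  by (metis mate_mate)

lemma mate_neq [simp]: "mate x \<noteq> x" "x \<noteq> mate x"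
  by (metis even_mate)+

lemma mate_less [simp]: "mate x < 2 * m \<longleftrightarrow> x < 2 * m"
  unfolding mate_def by presburger

lemma mate_le [simp]: "x < 2 * m \<Longrightarrow> mate x \<le> 2 * m" "x < 2 * m \<Longrightarrow> mate x \<noteq> 2 * m"
  using mate_less[of x m] by linarith+

text \<open>The vertex set is a parameter so that vertex deletion stays within the family.\<close>

definition crown :: "nat \<Rightarrow> nat set \<Rightarrow> (nat, nat \<times> nat) pre_digraph" where
  "crown m V = \<lparr>verts = V,
     arcs = {(x, y). x \<in> V \<and> y \<in> V \<and> x < 2 * m \<and> y < 2 * m \<and> even x \<noteq> even y \<and> y \<noteq> mate x},
     tail = fst, head = snd\<rparr>"

lemma verts_crown [simp]: "verts (crown m V) = V"
  by (simp add: crown_def)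

lemma crown_adj [simp]:
  "x \<rightarrow>\<^bsub>crown m V\<^esub> y \<longleftrightarrow>
     x \<in> V \<and> y \<in> V \<and> x < 2 * m \<and> y < 2 * m \<and> even x \<noteq> even y \<and> y \<noteq> mate x"
  by (force simp: crown_def arcs_ends_def arc_to_ends_def)

lemma del_vert_crown: "pre_digraph.del_vert (crown m V) x = crown m (V - {x})"
  by (auto simp: crown_def pre_digraph.del_vert_def)

lemma graph_crown:
  assumes "finite V"
  shows "graph (crown m V)"
proof
  show "finite (arcs (crown m V))"
    by (rule finite_subset[of _ "V \<times> V"]) (use assms in \<open>auto simp: crown_def\<close>)
  show "symmetric (crown m V)"
    by (auto simp: symmetric_def intro!: symI)
qed (use assms in \<open>auto simp: crown_def arc_to_ends_def\<close>)

text \<open>Each side has three vertices below 6, so one survives two exclusions. Where a single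
  exclusion is wanted, it is passed twice.\<close>

lemma ex_third_on_side:
  fixes m p q :: nat
  assumes "m \<ge> 3"
  obtains y where "y < 2 * m" "even y = b" "y \<noteq> p" "y \<noteq> q"
proof -
  have "\<exists>y < 6. even y = b \<and> y \<noteq> p \<and> y \<noteq> q"
  proof (cases b)
    case True
    have "\<exists>y \<in> {0, 2, 4 :: nat}. y \<noteq> p \<and> y \<noteq> q" by auto
    then obtain y where "y \<in> {0, 2, 4 :: nat}" "y \<noteq> p" "y \<noteq> q" by blast
    then show ?thesis using True by (intro exI[of _ y]) auto
  next
    case False
    have "\<exists>y \<in> {1, 3, 5 :: nat}. y \<noteq> p \<and> y \<noteq> q" by auto
    then obtain y where "y \<in> {1, 3, 5 :: nat}" "y \<noteq> p" "y \<noteq> q" by blast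
    then show ?thesis using False by (intro exI[of _ y]) auto
  qed
  then obtain y where "y < 6" "even y = b" "y \<noteq> p" "y \<noteq> q" by blast
  then show ?thesis using assms by (intro that[of y]) auto
qed

lemma bob_wins_crown_two:
  assumes "m \<ge> 3" "{..<2 * m} - {x} \<subseteq> V" "k < 2"
  shows "bob_wins (crown m V) k True Map.empty"
proof -
  obtain y where y: "y < 2 * m" "even y = True" "y \<noteq> x" "y \<noteq> x" by (rule ex_third_on_side[OF assms(1)])
  obtain z where z: "z < 2 * m" "even z = False" "z \<noteq> x" "z \<noteq> mate y"
    by (rule ex_third_on_side[OF assms(1)])
  show ?thesis
    by (rule bob_wins_edge[where x = y and y = z]) (use y z assms in auto)
qed

section \<open>The crown with an isolated vertex\<close>

lemma game_chromatic_number_crown_isolated: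
  assumes "m \<ge> 3"
  shows "game_chromatic_number (crown m {..2 * m}) = 2"
proof (rule game_chromatic_number_eqI)
  let ?G = "crown m {..2 * m}"
  show "graph ?G" by (rule graph_crown) simp
  \<comment> \<open>The whole crown is present, so the vertex to be avoided is arbitrary;
    \<open>0\<close> is taken.\<close>
  show "bob_wins ?G j True Map.empty" if "j < 2" for j
    by (rule bob_wins_crown_two[OF assms _ that, of 0]) auto
  show "\<exists>\<sigma>. winning_strategy ?G 2 \<sigma>"
  proof (rule winning_strategyI[where Q = "\<lambda>c. c = [2 * m \<mapsto> 1] \<or> reserved ?G 2 c"])
    show "\<exists>v i. legal_move ?G 2 Map.empty (v, i) \<and> ([v \<mapsto> i] = [2 * m \<mapsto> 1] \<or> reserved ?G 2 [v \<mapsto> i])"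
      by (rule exI[of _ "2 * m"], rule exI[of _ 1]) (simp add: legal_move_def)
    show "\<not> blocked_vertex_exists ?G 2 c" if "c = [2 * m \<mapsto> 1] \<or> reserved ?G 2 c" for c
      using that
    proof
      assume c: "c = [2 * m \<mapsto> 1]"
      show ?thesis unfolding blocked_vertex_exists_def c by (fastforce split: if_splits)
    qed (rule reserved_unblocked)
    fix c v i
    assume "c = [2 * m \<mapsto> 1] \<or> reserved ?G 2 c" and legal: "legal_move ?G 2 c (v, i)"
    then consider (isolated) "c = [2 * m \<mapsto> 1]" | (reserved) "reserved ?G 2 c" by blast
    then show "verts ?G \<subseteq> dom (c(v \<mapsto> i)) \<or> (\<exists>v' i'. legal_move ?G 2 (c(v \<mapsto> i)) (v', i') \<and>
        (c(v \<mapsto> i, v' \<mapsto> i') = [2 * m \<mapsto> 1] \<or> reserved ?G 2 (c(v \<mapsto> i, v' \<mapsto> i'))))"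
    proof cases
      case reserved
      then show ?thesis using reserved_reply[OF reserved_legal_move[OF reserved legal]] by blast
    next
      case isolated
      have v: "v < 2 * m" and i: "i \<in> {1, 2}"
        using legal by (auto simp: legal_move_def isolated split: if_splits)
      \<comment> \<open>The other one of the two colors.\<close>
      define j where "j = 3 - i"
      have j: "j \<in> {1, 2}" "j \<noteq> i" using i by (auto simp: j_def)
      let ?c = "c(v \<mapsto> i, mate v \<mapsto> j)"
      have "legal_move ?G 2 (c(v \<mapsto> i)) (mate v, j)"
        using v j by (auto simp: legal_move_def isolated less_imp_le mate_eq_iff)
      moreover have "reserved ?G 2 ?c"
        unfolding reserved_def
      \<comment> \<open>Each side reserves the color of its own member of the pair \<open>v\<close>,
        \<open>mate v\<close>. A vertex outside this pair is adjacent to the member on the opposite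
        side, hence cannot take that side's color.\<close>
      proof (rule exI[of _ "\<lambda>y. if even y = even v then i else j"], intro ballI conjI allI impI)
        fix y z assume yz: "z \<rightarrow>\<^bsub>?G\<^esub> y"
        show "?c z \<noteq> Some (if even y = even v then i else j)"
          using yz j by (auto simp: isolated)
        assume "?c z = None"
        then have "z \<noteq> v" "z \<noteq> mate v" by (auto split: if_splits)
        then show "\<exists>t. t \<rightarrow>\<^bsub>?G\<^esub> z \<and> ?c t = Some (if even y = even v then i else j)"
          using yz v by (intro exI[of _ "if even y = even v then v else mate v"])
auto
      qed (use i j in auto)
      ultimately show ?thesis by blast
    qed
  qed
qed

section \<open>The crown alone\<close>

text \<open>At Alice's turns each color in use occupies exactly one matched pair, an invariant that
  Bob restores by copying her color to the mate. A complete coloring would then need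
  \<open>m\<close> colors, so Alice gets stuck before the end.\<close>

lemma bob_wins_crown_copying:
  assumes "k < m"
    "\<And>y i. y < 2 * m \<Longrightarrow> c y = Some i \<Longrightarrow>
       i \<in> {1..k} \<and> (\<forall>z < 2 * m. c z = Some i \<longleftrightarrow> z = y \<or> z = mate y)"
  shows "bob_wins (crown m {..<2 * m}) k True c"
  using assms(2)
proof (induction "card ({..<2 * m} - dom c)" arbitrary: c rule: less_induct)
  case (less c)
  let ?G = "crown m {..<2 * m}"
  show ?case
  proof (rule bob_wins.alice)
    show "\<not> verts ?G \<subseteq> dom c"
    proof
      assume full: "verts ?G \<subseteq> dom c"
      have c: "c y = Some (the (c y))" if "y < 2 * m" for y
        using full that by force
      have "inj_on (\<lambda>a. the (c (2 * a))) {..<m}"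
      proof (rule inj_onI)
        fix a b assume ab: "a \<in> {..<m}" "b \<in> {..<m}" "the (c (2 * a)) = the (c (2 * b))"
        then obtain i where "c (2 * a) = Some i" "c (2 * b) = Some i"
          using c[of "2 * a"] c[of "2 * b"] by auto
        then have "2 * b = 2 * a \<or> 2 * b = mate (2 * a)"
          using less.prems[of "2 * a" i] ab by simp
        then show "a = b" by (auto simp: mate_def)
      qed
      moreover have "(\<lambda>a. the (c (2 * a))) ` {..<m} \<subseteq> {1..k}"
      proof (rule image_subsetI)
        fix a assume "a \<in> {..<m}"
        then have "2 * a < 2 * m" by simp
        from less.prems[OF this c[OF this]] show "the (c (2 * a)) \<in> {1..k}" by blast
      qed
      ultimately have "card {..<m} \<le> card {1..k}" by (rule card_inj_on_le) simp
      then show False using assms(1) by simp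
    qed
    fix v i assume legal: "legal_move ?G k c (v, i)"
    then have v: "v < 2 * m" "c v = None" "i \<in> {1..k}" "\<And>u. u \<rightarrow>\<^bsub>?G\<^esub> v \<Longrightarrow> c u \<noteq> Some i"
      by (auto simp: legal_move_def)
    \<comment> \<open>Matched vertices are colored together, so Bob's reply is still open.\<close>
    have mv: "c (mate v) = None"
    proof (rule ccontr)
      assume "c (mate v) \<noteq> None"
      then obtain b where "c (mate v) = Some b" by blast
      then have "c v = Some b" using less.prems[of "mate v" b] v(1) by auto
      then show False using v(2) by simp
    qed
    \<comment> \<open>Alice must use a fresh color: a pair already colored \<open>i\<close> has a
      member on the side opposite to \<open>v\<close>, and this member is not \<open>mate v\<close>,
      which is uncolored.\<close>
    have new: "c y \<noteq> Some i" if "y < 2 * m" for y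
    proof
      assume y: "c y = Some i"
      then have "c (mate y) = Some i" using less.prems[OF that] that by auto
      moreover have "y \<rightarrow>\<^bsub>?G\<^esub> v \<or> mate y \<rightarrow>\<^bsub>?G\<^esub> v"
        using that v(1,2) mv y calculation by auto
      ultimately show False using v(4) y by blast
    qed
    show "bob_wins ?G k False (c(v \<mapsto> i))"
    proof (rule bob_wins.bob)
      show "legal_move ?G k (c(v \<mapsto> i)) (mate v, i)"
        using v mv new by (auto simp: legal_move_def)
      show "bob_wins ?G k True (c(v \<mapsto> i, mate v \<mapsto> i))"
      proof (rule less.hyps)
        show "card ({..<2 * m} - dom (c(v \<mapsto> i, mate v \<mapsto> i))) < card ({..<2 * m} - dom c)"
          by (rule psubset_card_mono) (use v in auto)
        fix y a assume y: "y < 2 * m" "(c(v \<mapsto> i, mate v \<mapsto> i)) y = Some a"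
        show "a \<in> {1..k} \<and>
            (\<forall>z < 2 * m. (c(v \<mapsto> i, mate v \<mapsto> i)) z = Some a \<longleftrightarrow> z = y \<or> z = mate y)"
        proof (cases "y = v \<or> y = mate v")
          case True
          then show ?thesis using y v new by auto
        next
          case False
          then have cy: "c y = Some a" using y(2) by (auto split: if_splits)
          then have "a \<noteq> i" using new y(1) by blast
          moreover have "mate y \<noteq> v" "mate y \<noteq> mate v" using False by (auto simp: mate_eq_iff)
          ultimately show ?thesis using less.prems[OF y(1) cy] False by auto
        qed
      qed
    qed
  qed
qed

lemma game_chromatic_number_crown:
  assumes "m \<ge> 1"
  shows "game_chromatic_number (crown m {..<2 * m}) = m"
proof (rule game_chromatic_number_eqI)
  let ?G = "crown m {..<2 * m}"
  show "graph ?G" by (rule graph_crown) simp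
  show "bob_wins ?G j True Map.empty" if "j < m" for j
    by (rule bob_wins_crown_copying[OF that]) simp
  show "\<exists>\<sigma>. winning_strategy ?G m \<sigma>"
  proof (rule winning_strategy_small_degree)
    fix v assume "v \<in> verts ?G"
    then have v: "v < 2 * m" by simp
    let ?N = "{u. u \<rightarrow>\<^bsub>?G\<^esub> v}"
    have fin: "finite ?N" by (rule finite_subset[of _ "{..<2 * m}"]) auto
    \<comment> \<open>Halving numbers the matched pairs. The neighbors of \<open>v\<close> lie in
      distinct pairs other than its own, so there are at most \<open>m - 1\<close> of them.\<close>
    have "inj_on (\<lambda>u. u div 2) ?N"
      by (rule inj_onI) (auto, presburger+)
    moreover have "(\<lambda>u. u div 2) ` ?N \<subseteq> {..<m} - {v div 2}"
    proof clarify
      fix u assume "u \<rightarrow>\<^bsub>?G\<^esub> v"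
      moreover from this have "even u \<noteq> even v" "v \<noteq> mate u" by auto
      then have "u div 2 \<noteq> v div 2" unfolding mate_def by presburger
      ultimately show "u div 2 \<in> {..<m} - {v div 2}" by auto
    qed
    ultimately have "card ?N \<le> card ({..<m} - {v div 2})" by (rule card_inj_on_le) simp
    also have "\<dots> < m" using v assms by (subst card_Diff_singleton) auto
    finally show "finite ?N \<and> card ?N < m" using fin by blast
  next
    have "0 \<in> verts ?G" using assms by simp
    then show "verts ?G \<noteq> {}" by blast
  qed
qed

section \<open>Deletion of a crown vertex\<close>

context
  fixes m x :: nat
  assumes m: "m \<ge> 3" and x: "x < 2 * m"
begin

abbreviation "crown_del \<equiv> crown m ({..2 * m} - {x})"

text \<open>A vertex \<open>u\<close> on the side of \<open>x\<close> other than
  \<open>mate y\<close> is adjacent to both \<open>mate x\<close> and \<open>y\<close>, so it needs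
  a third color.\<close>

lemma dead_same_side:
  assumes "y < 2 * m" "odd y = even x" "c (mate x) = Some a" "c y = Some b" "a \<noteq> b"
  shows "dead_position crown_del 2 c"
proof (rule dead_positionI)
  fix e assume e: "\<And>v. v \<in> verts crown_del \<Longrightarrow> e v \<in> {1..2}"
    "\<And>u v. \<lbrakk>u \<in> verts crown_del; v \<in> verts crown_del; u \<rightarrow>\<^bsub>crown_del\<^esub> v\<rbrakk> \<Longrightarrow> e u \<noteq> e v"
    "\<And>v i. c v = Some i \<Longrightarrow> e v = i"
  obtain u where u: "u < 2 * m" "even u = even x" "u \<noteq> x" "u \<noteq> mate y"
    by (rule ex_third_on_side[OF m])
  have V: "mate x \<in> verts crown_del" "y \<in> verts crown_del" "u \<in> verts crown_del"
    using u x assms(1,2) by (auto simp: less_imp_le)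
  have "e u \<noteq> a" using e(2)[of "mate x" u] e(3)[OF assms(3)] V u x by auto
  moreover have "e u \<noteq> b" using e(2)[of y u] e(3)[OF assms(4)] V u assms(1,2) by auto
  ultimately show False
    using e(1)[OF V(1)] e(1)[OF V(2)] e(1)[OF V(3)] e(3)[OF assms(3)] e(3)[OF assms(4)] assms(5) by auto
qed

text \<open>Another vertex \<open>u\<close> on the side of \<open>x\<close> sees
  \<open>mate v\<close>, while \<open>mate x\<close> sees \<open>v\<close>; both must avoid
  \<open>a\<close>, yet they are adjacent and need different colors.\<close>

lemma dead_mates:
  assumes "v < 2 * m" "even v = even x" "v \<noteq> x" "c v = Some a" "c (mate v) = Some a"
  shows "dead_position crown_del 2 c"
proof (rule dead_positionI)
  fix e assume e: "\<And>v. v \<in> verts crown_del \<Longrightarrow> e v \<in> {1..2}"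
    "\<And>u v. \<lbrakk>u \<in> verts crown_del; v \<in> verts crown_del; u \<rightarrow>\<^bsub>crown_del\<^esub> v\<rbrakk> \<Longrightarrow> e u \<noteq> e v"
    "\<And>v i. c v = Some i \<Longrightarrow> e v = i"
  obtain u where u: "u < 2 * m" "even u = even x" "u \<noteq> x" "u \<noteq> v"
    by (rule ex_third_on_side[OF m])
  have V: "mate x \<in> verts crown_del" "v \<in> verts crown_del" "u \<in> verts crown_del" "mate v \<in> verts crown_del"
    using u x assms(1-3) by (auto simp: less_imp_le)
  have "e (mate x) \<noteq> a" using e(2)[of "mate x" v] e(3)[OF assms(4)] V x assms(1-3) by auto
  moreover have "e (mate x) \<noteq> e u" using e(2)[of "mate x" u] V x u by auto
  moreover have "e u \<noteq> a" using e(2)[of "mate v" u] e(3)[OF assms(5)] V u assms(1,2) by auto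
  ultimately show False
    using e(1)[OF V(1)] e(1)[OF V(2)] e(1)[OF V(3)] e(3)[OF assms(4)] by auto
qed

text \<open>With two colors Bob reaches one of the two dead patterns: he copies a color played on
  the side of \<open>x\<close> to the mate, or puts two colors on the other side, one of them on
  \<open>mate x\<close>.\<close>

lemma bob_wins_crown_del:
  assumes "k < 3"
  shows "bob_wins crown_del k True Map.empty"
proof (cases "k < 2")
  case True
  show ?thesis by (rule bob_wins_crown_two[OF m _ True, of x]) auto
next
  case False
  then have k: "k = 2" using assms by simp
  show ?thesis unfolding k
  proof (rule bob_wins.alice)
    have "2 * m \<in> verts crown_del" using x by simp
    then show "\<not> verts crown_del \<subseteq> dom Map.empty" by auto
    fix v i assume legal: "legal_move crown_del 2 Map.empty (v, i)"
    then have v: "v \<le> 2 * m" "v \<noteq> x" and i: "i \<in> {1, 2}" by (auto simp: legal_move_def)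
    consider "v = 2 * m" | "v < 2 * m" "even v = even x" | "v < 2 * m" "odd v = even x"
      using v by linarith
    then show "bob_wins crown_del 2 False [v \<mapsto> i]"
    proof cases
      \<comment> \<open>Alice has spent her move on the isolated vertex. Bob takes
        \<open>mate x\<close>, and every second move of hers either is already fatal or allows one
        of the two patterns.\<close>
      case 1
      show ?thesis
      proof (rule bob_wins.bob)
        show "legal_move crown_del 2 [v \<mapsto> i] (mate x, 1)"
          using \<open>v = 2 * m\<close> x by (auto simp: legal_move_def less_imp_le)
        show "bob_wins crown_del 2 True [v \<mapsto> i, mate x \<mapsto> 1]"
        proof (rule bob_wins.alice)
          show "\<not> verts crown_del \<subseteq> dom [v \<mapsto> i, mate x \<mapsto> 1]"
          proof -
            obtain y where "y < 2 * m" "even y = even x" "y \<noteq> x" "y \<noteq> x"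
              by (rule ex_third_on_side[OF m])
            then have "y \<in> verts crown_del - dom [v \<mapsto> i, mate x \<mapsto> 1]"
              using \<open>v = 2 * m\<close> by auto
            then show ?thesis by blast
          qed
          fix v' j assume "legal_move crown_del 2 [v \<mapsto> i, mate x \<mapsto> 1] (v', j)"
          then have v': "v' < 2 * m" "v' \<noteq> x" "v' \<noteq> mate x" and j: "j \<in> {1, 2}"
            and adj: "mate x \<rightarrow>\<^bsub>crown_del\<^esub> v' \<longrightarrow> j \<noteq> 1"
            using \<open>v = 2 * m\<close> by (auto simp: legal_move_def split: if_splits)
          let ?c = "[v \<mapsto> i, mate x \<mapsto> 1, v' \<mapsto> j]"
          show "bob_wins crown_del 2 False ?c"
          proof (cases "even v' = even x")
            case True
            then have j2: "j = 2" using adj j v' x by (auto simp: less_imp_le)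
            show ?thesis
            proof (rule bob_wins.bob)
              show "legal_move crown_del 2 ?c (mate v', 2)"
                using v' True x \<open>v = 2 * m\<close> by (auto simp: legal_move_def mate_eq_iff less_imp_le)
              show "bob_wins crown_del 2 True (?c(mate v' \<mapsto> 2))"
                by (rule bob_wins.dead, rule dead_mates[of v' _ 2]) (use v' True j2 in auto)
            qed
          next
            case False
            obtain y where y: "y < 2 * m" "even y = odd x" "y \<noteq> mate x" "y \<noteq> v'"
              by (rule ex_third_on_side[OF m])
            show ?thesis
            proof (cases "j = 1")
              case True
              show ?thesis
              proof (rule bob_wins.bob)
                show "legal_move crown_del 2 ?c (y, 2)"
                  using v' False True x y \<open>v = 2 * m\<close> by (auto simp: legal_move_def less_imp_le)
                show "bob_wins crown_del 2 True (?c(y \<mapsto> 2))"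
                  by (rule bob_wins.dead, rule dead_same_side[of y _ 1 2]) (use y v' in auto)
              qed
            next
              case j2: False
              show ?thesis
                by (rule bob_wins.dead, rule dead_same_side[of v' _ 1 j]) (use j2 v' False in auto)
            qed
          qed
        qed
      qed
    next
      case 2
      show ?thesis
      proof (rule bob_wins.bob)
        show "legal_move crown_del 2 [v \<mapsto> i] (mate v, i)"
          using 2 v i by (auto simp: legal_move_def less_imp_le)
        show "bob_wins crown_del 2 True ([v \<mapsto> i, mate v \<mapsto> i])"
          by (rule bob_wins.dead, rule dead_mates[of v _ i]) (use 2 v in auto)
      qed
    next
      case 3
      obtain y where y: "y < 2 * m" "even y = odd x" "y \<noteq> mate x" "y \<noteq> mate x"
        by (rule ex_third_on_side[OF m])
      \<comment> \<open>One of \<open>v\<close> and \<open>z\<close> has to be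
        \<open>mate x\<close>; if Alice has taken it already, any other vertex of that side will
        do.\<close>
      define z where "z = (if v = mate x then y else mate x)"
      have z: "z < 2 * m" "even z = odd x" "z \<noteq> v" "z = mate x \<or> v = mate x"
        using y x by (auto simp: z_def)
      define j where "j = 3 - i"
      have j: "j \<in> {1, 2}" "j \<noteq> i" using i by (auto simp: j_def)
      show ?thesis
      proof (rule bob_wins.bob)
        show "legal_move crown_del 2 [v \<mapsto> i] (z, j)"
          using 3 z j by (auto simp: legal_move_def less_imp_le)
        show "bob_wins crown_del 2 True [v \<mapsto> i, z \<mapsto> j]"
          using z(4)
        proof
          assume "z = mate x"
          then show ?thesis
            by (intro bob_wins.dead dead_same_side[of v _ j i]) (use 3 z j in auto)
        next
          assume "v = mate x"
          then show ?thesis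
            by (intro bob_wins.dead dead_same_side[of z _ i j]) (use 3 z j in auto)
        qed
      qed
    qed
  qed
qed

text \<open>The color 1 of \<open>mate x\<close>, which is adjacent to the whole side of \<open>x\<close>, stays available on its
  own side, and the color of \<open>u\<close> stays available on the side of \<open>x\<close>.\<close>

lemma reserved_crown_del:
  assumes "u < 2 * m" "even u = even x" "u \<noteq> x" "c u = Some b" "b \<in> {1..3}" "c (mate u) \<noteq> None"
    "c (mate x) = Some 1"
    "\<And>y. y < 2 * m \<Longrightarrow> odd y = even x \<Longrightarrow> c y \<noteq> Some b"
    "\<And>y. y < 2 * m \<Longrightarrow> even y = even x \<Longrightarrow> c y \<noteq> Some 1"
  shows "reserved crown_del 3 c"
  unfolding reserved_def
proof (rule exI[of _ "\<lambda>y. if even y = even x then b else 1"], intro ballI conjI allI impI)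
  fix y z assume yz: "z \<rightarrow>\<^bsub>crown_del\<^esub> y"
  show "c z \<noteq> Some (if even y = even x then b else 1)"
    using yz assms(8,9)[of z] by auto
  assume "c z = None"
  \<comment> \<open>On the side opposite to \<open>u\<close> only \<open>mate u\<close> misses
    \<open>u\<close>, and it is colored; \<open>mate x\<close> misses nothing on the other side
    because \<open>x\<close> is deleted.\<close>
  then have "z \<noteq> mate u" using assms(6) by auto
  then show "\<exists>t. t \<rightarrow>\<^bsub>crown_del\<^esub> z \<and> c t = Some (if even y = even x then b else 1)"
    using yz x assms(1-4,7) by (intro exI[of _ "if even y = even x then u else mate x"]) auto
qed (use assms(5) in auto)

text \<open>After Alice's first move on \<open>mate x\<close>, while Bob has played only on the isolated vertex,
  only the color 1 occurs, and only on the side of \<open>mate x\<close>.\<close>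

definition monochromatic :: "(nat \<rightharpoonup> nat) \<Rightarrow> bool" where
  "monochromatic c \<longleftrightarrow> c (mate x) = Some 1 \<and> (c = [mate x \<mapsto> 1] \<or> c (2 * m) \<noteq> None) \<and>
     (\<forall>y < 2 * m. c y = None \<or> c y = Some 1 \<and> odd y = even x)"

text \<open>The color 2 does not occur on the crown, so it is available at every uncolored
  vertex.\<close>

lemma monochromatic_unblocked: "monochromatic c \<Longrightarrow> \<not> blocked_vertex_exists crown_del 3 c"
  unfolding monochromatic_def blocked_vertex_exists_def
  by (auto simp: Bex_def intro!: exI[of _ "2::nat"])

lemma monochromatic_reply:
  assumes c: "monochromatic c" and legal: "legal_move crown_del 3 c (v, i)"
  shows "verts crown_del \<subseteq> dom (c(v \<mapsto> i)) \<or> (\<exists>v' i'. legal_move crown_del 3 (c(v \<mapsto> i)) (v', i') \<and>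
    (monochromatic (c(v \<mapsto> i, v' \<mapsto> i')) \<or> reserved crown_del 3 (c(v \<mapsto> i, v' \<mapsto> i'))))"
proof -
  have c1: "c (mate x) = Some 1" "c = [mate x \<mapsto> 1] \<or> c (2 * m) \<noteq> None"
    "\<And>y. y < 2 * m \<Longrightarrow> c y = None \<or> c y = Some 1 \<and> odd y = even x"
    using c by (auto simp: monochromatic_def)
  have v: "v \<le> 2 * m" "v \<noteq> x" "c v = None" "i \<in> {1..3}" "\<And>u. u \<rightarrow>\<^bsub>crown_del\<^esub> v \<Longrightarrow> c u \<noteq> Some i"
    using legal by (auto simp: legal_move_def)
  have vx: "v \<noteq> mate x" using v(3) c1(1) by auto
  consider (isolated) "v = 2 * m" | (opposite) "v < 2 * m" "even v = even x"
    | (same) "v < 2 * m" "odd v = even x"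
    using v by linarith
  then show ?thesis
  proof cases
    case isolated
    \<comment> \<open>Bob can pass the turn this way only once. Alice passes it back with another 1
      on the side of \<open>mate x\<close>.\<close>
    then have c_eq: "c = [mate x \<mapsto> 1]" using c1(2) v(3) by auto
    obtain y where y: "y < 2 * m" "even y = odd x" "y \<noteq> mate x" "y \<noteq> mate x"
      by (rule ex_third_on_side[OF m])
    have "legal_move crown_del 3 (c(v \<mapsto> i)) (y, 1)"
      using y isolated by (auto simp: legal_move_def c_eq)
    moreover have "monochromatic (c(v \<mapsto> i, y \<mapsto> 1))"
      using y isolated x by (auto simp: monochromatic_def c_eq)
    ultimately show ?thesis by blast
  next
    case opposite
    have "mate x \<rightarrow>\<^bsub>crown_del\<^esub> v" using opposite v x by (auto simp: less_imp_le)
    then have i1: "i \<noteq> 1" using v(5) c1(1) by blast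
    have others: "c y \<noteq> Some i" if "y < 2 * m" for y using c1(3)[OF that] i1 by auto
    have none: "c y = None" if "y < 2 * m" "even y = even x" for y using c1(3)[OF that(1)] that by auto
    \<comment> \<open>Bob's color \<open>i\<close> becomes the reserved color of the side of
      \<open>x\<close>. Only \<open>mate v\<close> could still bring it to the other side, so Alice
      gives \<open>mate v\<close> the color 1 unless it is already colored.\<close>
    show ?thesis
    proof (cases "c (mate v) = None")
      case True
      have "legal_move crown_del 3 (c(v \<mapsto> i)) (mate v, 1)"
        using opposite True none v(2) x by (auto simp: legal_move_def less_imp_le)
      moreover have "reserved crown_del 3 (c(v \<mapsto> i, mate v \<mapsto> 1))"
        by (rule reserved_crown_del[of v _ i])
          (use opposite v i1 others none c1(1) vx in \<open>auto simp: mate_eq_iff\<close>)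
      ultimately show ?thesis by blast
    next
      case False
      have "reserved crown_del 3 (c(v \<mapsto> i))"
        by (rule reserved_crown_del[of v _ i])
          (use opposite v i1 others none c1(1) vx False in auto)
      then show ?thesis using reserved_reply by blast
    qed
  next
    case same
    \<comment> \<open>Alice needs a color other than 1 and \<open>i\<close>, so that it is absent
      from the side of \<open>mate x\<close>; here the third color is used.\<close>
    define j :: nat where "j = (if i = 2 then 3 else 2)"
    have j: "j \<in> {1..3}" "j \<noteq> i" "j \<noteq> 1" by (auto simp: j_def)
    have others: "c y \<noteq> Some j" if "y < 2 * m" for y using c1(3)[OF that] j by auto
    have none: "c y = None" if "y < 2 * m" "even y = even x" for y using c1(3)[OF that(1)] that by auto
    have mvx: "mate v \<noteq> x" using vx by (auto simp: mate_eq_iff)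
    have "legal_move crown_del 3 (c(v \<mapsto> i)) (mate v, j)"
      using same none others mvx j by (auto simp: legal_move_def less_imp_le)
    moreover have "reserved crown_del 3 (c(v \<mapsto> i, mate v \<mapsto> j))"
      by (rule reserved_crown_del[of "mate v" _ j])
        (use same v j others none c1(1) vx mvx in \<open>auto simp: mate_eq_iff\<close>)
    ultimately show ?thesis by blast
  qed
qed

lemma game_chromatic_number_crown_del: "game_chromatic_number crown_del = 3"
proof (rule game_chromatic_number_eqI)
  show "graph crown_del" by (rule graph_crown) simp
  show "\<exists>\<sigma>. winning_strategy crown_del 3 \<sigma>"
  proof (rule winning_strategyI[where Q = "\<lambda>c. monochromatic c \<or> reserved crown_del 3 c"])
    show "\<exists>v i. legal_move crown_del 3 Map.empty (v, i) \<and> (monochromatic [v \<mapsto> i] \<or> reserved crown_del 3 [v \<mapsto> i])"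
      by (rule exI[of _ "mate x"], rule exI[of _ 1])
        (use x in \<open>auto simp: legal_move_def monochromatic_def less_imp_le\<close>)
    show "\<not> blocked_vertex_exists crown_del 3 c" if "monochromatic c \<or> reserved crown_del 3 c" for c
      using that monochromatic_unblocked reserved_unblocked by blast
    fix c v i
    assume legal: "legal_move crown_del 3 c (v, i)"
    assume "monochromatic c \<or> reserved crown_del 3 c"
    then show "verts crown_del \<subseteq> dom (c(v \<mapsto> i)) \<or> (\<exists>v' i'. legal_move crown_del 3 (c(v \<mapsto> i)) (v', i') \<and>
        (monochromatic (c(v \<mapsto> i, v' \<mapsto> i')) \<or> reserved crown_del 3 (c(v \<mapsto> i, v' \<mapsto> i'))))"
    proof
      assume "reserved crown_del 3 c"
      from reserved_reply[OF reserved_legal_move[OF this legal]] show ?thesis by blast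
    qed (rule monochromatic_reply[OF _ legal])
  qed
qed (rule bob_wins_crown_del)

end

theorem proposition7:
  fixes n :: nat
  assumes "n \<ge> 1"
  shows "\<exists>G :: (nat, nat \<times> nat) pre_digraph.
           graph G \<and> upper_game_vertex_critical G \<and>
           {int (game_chromatic_number G)
              - int (game_chromatic_number (pre_digraph.del_vert G x)) | x. x \<in> verts G}
           = {-1, - int n}"
proof -
  \<comment> \<open>Deleting the isolated vertex yields the difference \<open>2 - m\<close>, which
    is to be \<open>- n\<close>; then \<open>n \<ge> 1\<close> gives the three vertices per side
    used throughout.\<close>
  define m where "m = n + 2"
  have m: "m \<ge> 3" using assms by (simp add: m_def)
  let ?G = "crown m {..2 * m}"
  have G: "game_chromatic_number ?G = 2" by (rule game_chromatic_number_crown_isolated[OF m])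
  have core: "game_chromatic_number (pre_digraph.del_vert ?G x) = 3" if "x < 2 * m" for x
    using game_chromatic_number_crown_del[OF m that] by (simp add: del_vert_crown)
  have "{..2 * m} - {2 * m} = {..<2 * m}" by auto
  then have isolated: "game_chromatic_number (pre_digraph.del_vert ?G (2 * m)) = m"
    using game_chromatic_number_crown[of m] m by (simp add: del_vert_crown)
  have cases: "x < 2 * m \<or> x = 2 * m" if "x \<in> verts ?G" for x using that by auto
  have "graph ?G" by (rule graph_crown) simp
  moreover have "upper_game_vertex_critical ?G"
    unfolding upper_game_vertex_critical_def using cases core isolated G m by fastforce
  moreover have "{int (game_chromatic_number ?G)
      - int (game_chromatic_number (pre_digraph.del_vert ?G x)) | x. x \<in> verts ?G} = {-1, - int n}"
    (is "?D = _")
  proof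
    show "?D \<subseteq> {-1, - int n}"
    proof
      fix d assume "d \<in> ?D"
      then obtain x where x: "x \<in> verts ?G" and d:
        "d = int (game_chromatic_number ?G) - int (game_chromatic_number (pre_digraph.del_vert ?G x))"
        by blast
      from cases[OF x] show "d \<in> {-1, - int n}"
      proof
        assume "x < 2 * m"
        then show ?thesis using d core G by simp
      next
        assume "x = 2 * m"
        then have "d = 2 - int m" using d isolated G by simp
        then show ?thesis by (simp add: m_def)
      qed
    qed
    \<comment> \<open>The vertex \<open>0\<close>, standing for any crown vertex, attains -1, and
      the isolated vertex \<open>2 * m\<close> attains \<open>- n\<close>.\<close>
    have "int 2 - int (game_chromatic_number (pre_digraph.del_vert ?G 0)) \<in> ?D" using G by force
    moreover have "int 2 - int (game_chromatic_number (pre_digraph.del_vert ?G (2 * m))) \<in> ?D"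
      using G by force
    ultimately show "{-1, - int n} \<subseteq> ?D" using core[of 0] isolated m by (simp add: m_def)
  qed
  ultimately show ?thesis by blast
qed

end
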